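(* Let $(W,S)$ be a Coxeter system with $W$ finite, with longest element $w_0$. Let $w,x,y\in W$ satisfy $w(\Phi_x)=\Phi_y$. Then $w$ is a right divisor of $w_0x^{-1}$.
   Context: Let $(W,S)$ be a Coxeter system with Coxeter matrix $m$ and length function $\ell$. Let $V$ be the real vector space with basis $\Pi=\{\alpha_s \mid s\in S\}$ (the simple roots), with symmetric bilinear form $B(\alpha_s,\alpha_{s'})=-\cos(\pi/m(s,s'))$ (equal to $-1$ if $m(s,s')=\infty$). $W$ acts on $V$ by $s(v)=v-2B(v,\alpha_s)\alpha_s$ for $s\in S$. Put $\Phi=\{w(\alpha_s)\mid w\in W, s\in S\}$, let $\Phi^+$ be the set of elements of $\Phi$ that are nonnegative linear combinations of $\Pi$, and $\Phi^-=-\Phi^+$. The left inversion set of $w\in W$ is $\Phi_w=\{\beta\in\Phi^+ \mid w^{-1}(\beta)\in\Phi^-\}$. An element $w$ is a right divisor of $u\in W$ if $u=gw$ for some $g\in W$ with $\ell(u)=\ell(g)+\ell(w)$. *)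

theory Defs
  imports Complex_Main "HOL-Library.Extended_Nat" "HOL-Algebra.Generated_Groups"
begin

section \<open>Group presentations\<close>

text \<open>A group word over \<open>S\<close> is a list of letters \<open>(s, b)\<close>, where \<open>(s, True)\<close> stands for \<open>s\<close> and
  \<open>(s, False)\<close> for its formal inverse.\<close>

definition signed_words :: "'a set \<Rightarrow> ('a \<times> bool) list set" where
  "signed_words S = lists (S \<times> UNIV)"

definition signed_value :: "('a, 'b) monoid_scheme \<Rightarrow> ('a \<times> bool) list \<Rightarrow> 'a" where
  "signed_value G u =
     foldr (\<lambda>(s, b) g. (if b then s else inv\<^bsub>G\<^esub> s) \<otimes>\<^bsub>G\<^esub> g) u \<one>\<^bsub>G\<^esub>"

text \<open>Two words are related iff they represent the same element of the abstract group with generators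
  \<open>S\<close> and relators \<open>R\<close>, that is, of the free group on \<open>S\<close> modulo the normal closure of \<open>R\<close>.\<close>

inductive presentation_eq ::
  "'a set \<Rightarrow> ('a \<times> bool) list set \<Rightarrow> ('a \<times> bool) list \<Rightarrow> ('a \<times> bool) list \<Rightarrow> bool"
  for S :: "'a set" and R :: "('a \<times> bool) list set" where
  refl: "u \<in> signed_words S \<Longrightarrow> presentation_eq S R u u"
| sym: "presentation_eq S R u v \<Longrightarrow> presentation_eq S R v u"
| trans: "presentation_eq S R u v \<Longrightarrow> presentation_eq S R v w \<Longrightarrow> presentation_eq S R u w"
| cancel: "u \<in> signed_words S \<Longrightarrow> v \<in> signed_words S \<Longrightarrow> s \<in> S \<Longrightarrow>
    presentation_eq S R (u @ [(s, b), (s, \<not> b)] @ v) (u @ v)"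
| relator: "u \<in> signed_words S \<Longrightarrow> v \<in> signed_words S \<Longrightarrow> r \<in> R \<Longrightarrow>
    presentation_eq S R (u @ r @ v) (u @ v)"

definition has_presentation ::
  "('a, 'b) monoid_scheme \<Rightarrow> 'a set \<Rightarrow> ('a \<times> bool) list set \<Rightarrow> bool" where
  "has_presentation G S R \<longleftrightarrow>
     group G \<and> S \<subseteq> carrier G \<and> R \<subseteq> signed_words S \<and> generate G S = carrier G \<and>
     (\<forall>u \<in> signed_words S. \<forall>v \<in> signed_words S.
        signed_value G u = signed_value G v \<longleftrightarrow> presentation_eq S R u v)"

section \<open>Coxeter systems\<close>

definition coxeter_matrix :: "'a set \<Rightarrow> ('a \<Rightarrow> 'a \<Rightarrow> enat) \<Rightarrow> bool" where
  "coxeter_matrix S m \<longleftrightarrow>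
     (\<forall>s \<in> S. m s s = 1) \<and>
     (\<forall>s \<in> S. \<forall>t \<in> S. m s t = m t s \<and> (s \<noteq> t \<longrightarrow> 2 \<le> m s t))"

definition coxeter_relators :: "'a set \<Rightarrow> ('a \<Rightarrow> 'a \<Rightarrow> enat) \<Rightarrow> ('a \<times> bool) list set" where
  "coxeter_relators S m =
     {concat (replicate k [(s, True), (t, True)]) | s t k. s \<in> S \<and> t \<in> S \<and> m s t = enat k}"

definition coxeter_system ::
  "('a, 'b) monoid_scheme \<Rightarrow> 'a set \<Rightarrow> ('a \<Rightarrow> 'a \<Rightarrow> enat) \<Rightarrow> bool" where
  "coxeter_system W S m \<longleftrightarrow>
     coxeter_matrix S m \<and> has_presentation W S (coxeter_relators S m)"

definition word_value :: "('a, 'b) monoid_scheme \<Rightarrow> 'a list \<Rightarrow> 'a" where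
  "word_value W ss = foldr (\<otimes>\<^bsub>W\<^esub>) ss \<one>\<^bsub>W\<^esub>"

definition cox_length :: "('a, 'b) monoid_scheme \<Rightarrow> 'a set \<Rightarrow> 'a \<Rightarrow> nat" where
  "cox_length W S w = (LEAST n. \<exists>ss \<in> lists S. length ss = n \<and> word_value W ss = w)"

definition longest_element :: "('a, 'b) monoid_scheme \<Rightarrow> 'a set \<Rightarrow> 'a \<Rightarrow> bool" where
  "longest_element W S w \<longleftrightarrow>
     w \<in> carrier W \<and> (\<forall>u \<in> carrier W. cox_length W S u \<le> cox_length W S w)"

definition right_divisor :: "('a, 'b) monoid_scheme \<Rightarrow> 'a set \<Rightarrow> 'a \<Rightarrow> 'a \<Rightarrow> bool" where
  "right_divisor W S w u \<longleftrightarrow>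
     (\<exists>g \<in> carrier W. u = g \<otimes>\<^bsub>W\<^esub> w \<and> cox_length W S u = cox_length W S g + cox_length W S w)"

section \<open>The geometric representation and the root system\<close>

text \<open>A vector \<open>\<Sum>s\<in>S. v s \<cdot> \<alpha>\<^sub>s\<close> of \<open>V\<close> is encoded by its coefficient function \<open>v\<close>, which has finite
  support contained in \<open>S\<close>; functions not of this form carry no meaning.\<close>

definition simple_root :: "'a \<Rightarrow> 'a \<Rightarrow> real" where
  "simple_root s = (\<lambda>t. if t = s then 1 else 0)"

definition simple_form :: "('a \<Rightarrow> 'a \<Rightarrow> enat) \<Rightarrow> 'a \<Rightarrow> 'a \<Rightarrow> real" where
  "simple_form m s t = (case m s t of enat k \<Rightarrow> - cos (pi / real k) | \<infinity> \<Rightarrow> - 1)"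

definition cox_form ::
  "('a \<Rightarrow> 'a \<Rightarrow> enat) \<Rightarrow> ('a \<Rightarrow> real) \<Rightarrow> ('a \<Rightarrow> real) \<Rightarrow> real" where
  "cox_form m u v = (\<Sum>s | u s \<noteq> 0. \<Sum>t | v t \<noteq> 0. u s * v t * simple_form m s t)"

definition simple_reflection ::
  "('a \<Rightarrow> 'a \<Rightarrow> enat) \<Rightarrow> 'a \<Rightarrow> ('a \<Rightarrow> real) \<Rightarrow> 'a \<Rightarrow> real" where
  "simple_reflection m s v = (\<lambda>t. v t - 2 * cox_form m v (simple_root s) * simple_root s t)"

text \<open>An element of \<open>W\<close> acts through any expression as a product of generators: on \<open>V\<close> the simple
  reflections satisfy the defining relations, so the choice of expression does not matter.\<close>

definition cox_act ::
  "('a, 'b) monoid_scheme \<Rightarrow> 'a set \<Rightarrow> ('a \<Rightarrow> 'a \<Rightarrow> enat) \<Rightarrow> 'a \<Rightarrow> ('a \<Rightarrow> real) \<Rightarrow> 'a \<Rightarrow> real" where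
  "cox_act W S m w =
     foldr (simple_reflection m) (SOME ss. ss \<in> lists S \<and> word_value W ss = w)"

definition roots ::
  "('a, 'b) monoid_scheme \<Rightarrow> 'a set \<Rightarrow> ('a \<Rightarrow> 'a \<Rightarrow> enat) \<Rightarrow> ('a \<Rightarrow> real) set" where
  "roots W S m = {cox_act W S m w (simple_root s) | w s. w \<in> carrier W \<and> s \<in> S}"

definition positive_roots ::
  "('a, 'b) monoid_scheme \<Rightarrow> 'a set \<Rightarrow> ('a \<Rightarrow> 'a \<Rightarrow> enat) \<Rightarrow> ('a \<Rightarrow> real) set" where
  "positive_roots W S m = {\<beta> \<in> roots W S m. \<forall>s. 0 \<le> \<beta> s}"

definition negative_roots ::
  "('a, 'b) monoid_scheme \<Rightarrow> 'a set \<Rightarrow> ('a \<Rightarrow> 'a \<Rightarrow> enat) \<Rightarrow> ('a \<Rightarrow> real) set" where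
  "negative_roots W S m = (\<lambda>\<beta> s. - \<beta> s) ` positive_roots W S m"

definition inversion_set ::
  "('a, 'b) monoid_scheme \<Rightarrow> 'a set \<Rightarrow> ('a \<Rightarrow> 'a \<Rightarrow> enat) \<Rightarrow> 'a \<Rightarrow> ('a \<Rightarrow> real) set" where
  "inversion_set W S m w =
     {\<beta> \<in> positive_roots W S m. cox_act W S m (inv\<^bsub>W\<^esub> w) \<beta> \<in> negative_roots W S m}"

end

theory Submission
  imports Defs
begin

text \<open>By the hypothesis, \<open>w\<close> maps \<open>\<Phi>\<^sub>x\<close> to positive roots: no positive root is made
  negative by both \<open>w\<close> and \<open>x\<^bsup>-1\<^esup>\<close>, so the sign changes of \<open>w\<close> and \<open>x\<close> never cancel, and
  \<open>\<Phi>\<^bsub>wx\<^esub>\<close> is the disjoint union of \<open>\<Phi>\<^sub>w\<close> and \<open>w(\<Phi>\<^sub>x)\<close>. As the size of an inversion set is the length,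
  \<open>\<ell>(wx) = \<ell>(w) + \<ell>(x)\<close> (\<open>len_mult_of_positive\<close>). Multiplication by the longest element
  complements inversion sets, so \<open>\<ell>(w\<^sub>0g) = \<ell>(w\<^sub>0) - \<ell>(g)\<close> (\<open>len_longest_mult\<close>). With
  \<open>g = w\<^sub>0(wx)\<^bsup>-1\<^esup>\<close> one has \<open>w\<^sub>0x\<^bsup>-1\<^esup> = gw\<close>, and the lengths of
  \<open>g\<close>, \<open>w\<close> and \<open>w\<^sub>0x\<^bsup>-1\<^esup>\<close> are \<open>\<ell>(w\<^sub>0) - \<ell>(w) - \<ell>(x)\<close>, \<open>\<ell>(w)\<close> and \<open>\<ell>(w\<^sub>0) - \<ell>(x)\<close>, which add up.

  Both facts rest on the equality of length and number of inversions (\<open>card_inversion_set\<close>), whose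
  source is the sign theorem \<open>ascent_nonneg\<close>: if \<open>\<ell>(gs) > \<ell>(g)\<close> then \<open>g(\<alpha>\<^sub>s)\<close> is a nonnegative
  combination of simple roots. That theorem is reduced to dihedral subgroups, where the
  coordinates of the roots are values of Chebyshev polynomials of the second kind. The same
  computation shows that the simple reflections satisfy the defining relations of \<open>W\<close>, which makes
  the action of \<open>W\<close> independent of the chosen word.\<close>

section \<open>Chebyshev polynomials\<close>

text \<open>The index is shifted by one from the usual \<open>U\<^sub>k\<close>, so that \<open>cheb c 0 = 0\<close> and
  \<open>cheb (cos \<theta>) k = sin (k\<theta>) / sin \<theta>\<close>; in a dihedral group with \<open>m(s,t) = n\<close>, sign changes
  then occur exactly at multiples of \<open>n\<close>.\<close>
fun cheb :: "real \<Rightarrow> nat \<Rightarrow> real" where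
  "cheb c 0 = 0"
| "cheb c (Suc 0) = 1"
| "cheb c (Suc (Suc k)) = 2 * c * cheb c (Suc k) - cheb c k"

text \<open>The parameter \<open>1\<close> belongs to infinite dihedral groups, where the form takes the value \<open>-1\<close>.\<close>
lemma cheb_one: "cheb 1 k = real k"
  by (induction "1::real" k rule: cheb.induct) auto

lemma cheb_cos: "cheb (cos \<theta>) k * sin \<theta> = sin (real k * \<theta>)"
proof (induction "cos \<theta>" k rule: cheb.induct)
  case (3 k)
  have "sin (real (Suc (Suc k)) * \<theta>) + sin (real k * \<theta>) = 2 * cos \<theta> * sin (real (Suc k) * \<theta>)"
    using sin_plus_sin[of "real (Suc (Suc k)) * \<theta>" "real k * \<theta>"]
    by (simp add: algebra_simps add_divide_distrib)
  with 3 show ?case by (simp add: algebra_simps)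
qed auto

lemma sin_pi_div_pos: "2 \<le> n \<Longrightarrow> 0 < sin (pi / real n)"
  by (rule sin_gt_zero) (auto simp: field_simps)

lemma cheb_cos_nonneg:
  assumes "2 \<le> n" "k \<le> n"
  shows "0 \<le> cheb (cos (pi / real n)) k"
proof -
  have "0 \<le> sin (real k * (pi / real n))"
    using assms by (intro sin_ge_zero) (auto simp: field_simps)
  with sin_pi_div_pos[OF assms(1)] show ?thesis
    by (metis cheb_cos mult_less_0_iff not_less)
qed

text \<open>These are the values reached after a full turn by the angle \<open>2\<pi>\<close>; they express that \<open>(st)\<^sup>n\<close>
  acts trivially on the plane of \<open>\<alpha>\<^sub>s\<close> and \<open>\<alpha>\<^sub>t\<close>.\<close>
lemma cheb_cos_period:
  assumes "2 \<le> n"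
  shows "cheb (cos (pi / real n)) (2 * n) = 0"
    and "cheb (cos (pi / real n)) (Suc (2 * n)) = 1"
    and "cheb (cos (pi / real n)) (2 * n - 1) = - 1"
proof -
  let ?\<theta> = "pi / real n"
  have pos: "sin ?\<theta> \<noteq> 0" using sin_pi_div_pos[OF assms] by simp
  have e0: "real (2 * n) * ?\<theta> = 2 * pi" using assms by (simp add: field_simps)
  have e1: "real (Suc (2 * n)) * ?\<theta> = ?\<theta> + 2 * pi" using assms by (simp add: field_simps)
  have e2: "real (2 * n - 1) * ?\<theta> = 2 * pi - ?\<theta>"
    using assms by (simp add: field_simps of_nat_diff)
  show "cheb (cos ?\<theta>) (2 * n) = 0"
    using cheb_cos[of ?\<theta> "2 * n"] pos unfolding e0 by simp
  show "cheb (cos ?\<theta>) (Suc (2 * n)) = 1"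
    using cheb_cos[of ?\<theta> "Suc (2 * n)"] pos unfolding e1 by simp
  have "cheb (cos ?\<theta>) (2 * n - 1) * sin ?\<theta> = - 1 * sin ?\<theta>"
    using cheb_cos[of ?\<theta> "2 * n - 1"] unfolding e2 by (simp add: sin_diff)
  with pos show "cheb (cos ?\<theta>) (2 * n - 1) = - 1"
    using mult_right_cancel by blast
qed

section \<open>Alternating words\<close>

text \<open>The last letter is held fixed at \<open>t\<close>, since it is the last letter that acts first on a
  vector; the first letter therefore depends on the parity of the length.\<close>
fun alt_word :: "'a \<Rightarrow> 'a \<Rightarrow> nat \<Rightarrow> 'a list" where
  "alt_word s t 0 = []"
| "alt_word s t (Suc k) = alt_word t s k @ [t]"

lemma length_alt_word [simp]: "length (alt_word s t k) = k"
  by (induction s t k rule: alt_word.induct) auto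

lemma alt_word_in_lists: "s \<in> A \<Longrightarrow> t \<in> A \<Longrightarrow> alt_word s t k \<in> lists A"
  by (induction s t k rule: alt_word.induct) auto

lemma alt_word_Cons: "alt_word s t (Suc k) = (if even k then t else s) # alt_word s t k"
  by (induction s t k rule: alt_word.induct) auto

lemma alt_word_add:
  "alt_word s t (j + k) = (if even k then alt_word s t j else alt_word t s j) @ alt_word s t k"
  by (induction s t k rule: alt_word.induct) auto

lemma rev_alt_word: "rev (alt_word s t k) = (if even k then alt_word t s k else alt_word s t k)"
proof (induction s t k rule: alt_word.induct)
  case (2 s t k)
  have "rev (alt_word s t (Suc k)) = t # rev (alt_word t s k)" by simp
  also have "\<dots> = (if even (Suc k) then alt_word t s (Suc k) else alt_word s t (Suc k))"
    unfolding 2 alt_word_Cons by simp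
  finally show ?case .
qed auto

lemma concat_replicate_alt_word: "concat (replicate n [s, t]) = alt_word s t (2 * n)"
  by (induction n) (simp_all add: alt_word_Cons del: alt_word.simps(2))

section \<open>Words and lengths\<close>

text \<open>Finite rank lets the form be written as a sum over all of \<open>S\<close>, which
  makes it bilinear without any condition on supports.\<close>
locale finite_rank_coxeter =
  fixes W :: "('a, 'b) monoid_scheme" (structure) and S :: "'a set" and m :: "'a \<Rightarrow> 'a \<Rightarrow> enat"
  assumes cox: "coxeter_system W S m" and finite_S: "finite S"
begin

lemma presentation: "has_presentation W S (coxeter_relators S m)"
  using cox by (simp add: coxeter_system_def)

sublocale group W
  using presentation by (simp add: has_presentation_def)

lemma S_carrier: "s \<in> S \<Longrightarrow> s \<in> carrier W"
  using presentation by (auto simp: has_presentation_def)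

lemma m_diag: "s \<in> S \<Longrightarrow> m s s = 1"
  and m_sym: "s \<in> S \<Longrightarrow> t \<in> S \<Longrightarrow> m s t = m t s"
  and m_ge: "s \<in> S \<Longrightarrow> t \<in> S \<Longrightarrow> s \<noteq> t \<Longrightarrow> 2 \<le> m s t"
  using cox by (auto simp: coxeter_system_def coxeter_matrix_def)

lemma word_value_Nil [simp]: "word_value W [] = \<one>"
  and word_value_Cons [simp]: "word_value W (s # ss) = s \<otimes> word_value W ss"
  by (auto simp: word_value_def)

lemma word_value_closed [simp]: "ss \<in> lists S \<Longrightarrow> word_value W ss \<in> carrier W"
  by (induction ss) (auto intro: S_carrier)

lemma word_value_append:
  "ss \<in> lists S \<Longrightarrow> ts \<in> lists S \<Longrightarrow> word_value W (ss @ ts) = word_value W ss \<otimes> word_value W ts"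
  by (induction ss) (auto simp: S_carrier m_assoc)

abbreviation positive_word :: "'a list \<Rightarrow> ('a \<times> bool) list" where
  "positive_word ss \<equiv> map (\<lambda>s. (s, True)) ss"

lemma signed_value_positive_word: "signed_value W (positive_word ss) = word_value W ss"
  by (induction ss) (auto simp: signed_value_def)

lemma positive_word_signed: "ss \<in> lists S \<Longrightarrow> positive_word ss \<in> signed_words S"
  by (auto simp: signed_words_def)

lemma word_value_eq_iff:
  assumes "ss \<in> lists S" "ts \<in> lists S"
  shows "word_value W ss = word_value W ts \<longleftrightarrow>
    presentation_eq S (coxeter_relators S m) (positive_word ss) (positive_word ts)"
  using presentation positive_word_signed[OF assms(1)] positive_word_signed[OF assms(2)]
  by (simp add: has_presentation_def signed_value_positive_word[symmetric])

lemma dihedral_relation: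
  assumes "s \<in> S" "t \<in> S" "m s t = enat n"
  shows "word_value W (alt_word s t (2 * n)) = \<one>"
proof -
  have "presentation_eq S (coxeter_relators S m)
      ([] @ concat (replicate n [(s, True), (t, True)]) @ []) ([] @ [])"
    using assms by (intro presentation_eq.relator)
      (auto simp: coxeter_relators_def signed_words_def)
  moreover have "concat (replicate n [(s, True), (t, True)]) = positive_word (alt_word s t (2 * n))"
    by (simp add: concat_replicate_alt_word[symmetric] map_concat)
  ultimately show ?thesis
    using word_value_eq_iff[of "alt_word s t (2 * n)" "[]"] assms alt_word_in_lists[of s S t]
    by simp
qed

lemma generator_square: "s \<in> S \<Longrightarrow> s \<otimes> s = \<one>"
  using dihedral_relation[of s s 1] m_diag[of s] S_carrier[of s]
  by (simp add: one_enat_def numeral_2_eq_2)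

lemma generator_inv: "s \<in> S \<Longrightarrow> inv s = s"
  using generator_square S_carrier inv_equality by blast

lemma word_value_rev: "ss \<in> lists S \<Longrightarrow> word_value W (rev ss) = inv (word_value W ss)"
proof (induction ss)
  case (Cons s ss)
  then have "rev ss \<in> lists S" "s \<in> S" "ss \<in> lists S" by (auto simp: in_lists_conv_set)
  with Cons.IH show ?case
    by (simp add: word_value_append[of "rev ss"] S_carrier inv_mult_group generator_inv)
qed simp

text \<open>Cutting the relation \<open>(st)\<^sup>n = 1\<close> in the middle, the right half is the inverse of the left
  half; as generators are involutions, that inverse is the reversed word, which is the other
  alternating word.\<close>
lemma braid_relation:
  assumes "s \<in> S" "t \<in> S" "m s t = enat n"
  shows "word_value W (alt_word s t n) = word_value W (alt_word t s n)"
proof -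
  define X where "X = (if even n then alt_word s t n else alt_word t s n)"
  have L: "X \<in> lists S" "alt_word s t n \<in> lists S" "alt_word t s n \<in> lists S"
    using assms by (auto simp: X_def alt_word_in_lists)
  have "word_value W X \<otimes> word_value W (alt_word s t n) = \<one>"
    using dihedral_relation[OF assms] alt_word_add[of s t n n] word_value_append[OF L(1,2)]
    by (simp add: X_def mult_2)
  hence "word_value W (alt_word s t n) = inv (word_value W X)"
    using L by (metis inv_comm inv_equality word_value_closed)
  also have "\<dots> = word_value W (rev X)" using L by (simp add: word_value_rev)
  also have "rev X = alt_word t s n" by (auto simp: X_def rev_alt_word)
  finally show ?thesis .
qed

lemma word_exists:
  assumes "g \<in> carrier W"
  shows "\<exists>ss \<in> lists S. word_value W ss = g"
proof -
  have "g \<in> generate W S" using assms presentation by (simp add: has_presentation_def)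
  thus ?thesis
  proof (induction rule: generate.induct)
    case one
    show ?case by (rule bexI[of _ "[]"]) auto
  next
    case (incl h)
    then show ?case by (intro bexI[of _ "[h]"]) (auto simp: S_carrier)
  next
    case (inv h)
    then show ?case by (intro bexI[of _ "[h]"]) (auto simp: S_carrier generator_inv)
  next
    case (eng g h)
    then obtain ss ts where "ss \<in> lists S" "ts \<in> lists S" "word_value W ss = g" "word_value W ts = h"
      by blast
    then show ?case by (intro bexI[of _ "ss @ ts"]) (auto simp: word_value_append)
  qed
qed

abbreviation len :: "'a \<Rightarrow> nat" where "len \<equiv> cox_length W S"

lemma len_word_le: "ss \<in> lists S \<Longrightarrow> len (word_value W ss) \<le> length ss"
  unfolding cox_length_def by (rule Least_le) blast

lemma reduced_word_exists:
  assumes "g \<in> carrier W"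
  obtains ss where "ss \<in> lists S" "word_value W ss = g" "length ss = len g"
proof -
  have "\<exists>n. \<exists>ss\<in>lists S. length ss = n \<and> word_value W ss = g"
    using word_exists[OF assms] by blast
  from LeastI_ex[OF this] show ?thesis using that unfolding cox_length_def by blast
qed

lemma len_mult_le:
  assumes "g \<in> carrier W" "h \<in> carrier W"
  shows "len (g \<otimes> h) \<le> len g + len h"
proof -
  obtain ss where ss: "ss \<in> lists S" "word_value W ss = g" "length ss = len g"
    using reduced_word_exists[OF assms(1)] .
  obtain ts where ts: "ts \<in> lists S" "word_value W ts = h" "length ts = len h"
    using reduced_word_exists[OF assms(2)] .
  show ?thesis using len_word_le[of "ss @ ts"] ss ts by (simp add: word_value_append)
qed

lemma len_mult_word_le:
  "g \<in> carrier W \<Longrightarrow> ss \<in> lists S \<Longrightarrow> len (g \<otimes> word_value W ss) \<le> len g + length ss"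
  using len_mult_le[of g "word_value W ss"] len_word_le[of ss] by simp

lemma len_one [simp]: "len \<one> = 0"
  using len_word_le[of "[]"] by simp

lemma len_eq_0_iff: "g \<in> carrier W \<Longrightarrow> len g = 0 \<longleftrightarrow> g = \<one>"
  by (metis len_one length_0_conv reduced_word_exists word_value_Nil)

lemma len_inv:
  assumes "g \<in> carrier W"
  shows "len (inv g) = len g"
proof -
  have le: "len (inv h) \<le> len h" if h: "h \<in> carrier W" for h
  proof -
    obtain ss where "ss \<in> lists S" "word_value W ss = h" "length ss = len h"
      using reduced_word_exists[OF h] .
    thus ?thesis using len_word_le[of "rev ss"] by (simp add: word_value_rev in_lists_conv_set)
  qed
  show ?thesis using le[OF assms] le[of "inv g"] assms by simp
qed

text \<open>All relators have even length, so \<open>W\<close> has a sign character; this is what excludes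
  \<open>\<ell>(gs) = \<ell>(g)\<close>.\<close>
lemma presentation_eq_parity:
  assumes "presentation_eq S (coxeter_relators S m) u v"
  shows "even (length u) = even (length v)"
  using assms
proof (induction rule: presentation_eq.induct)
  case (relator u v r)
  then show ?case
    by (auto simp: coxeter_relators_def length_concat sum_list_replicate)
qed auto

lemma word_parity:
  assumes "ss \<in> lists S"
  shows "even (length ss) = even (len (word_value W ss))"
proof -
  obtain ts where "ts \<in> lists S" "word_value W ts = word_value W ss"
    "length ts = len (word_value W ss)"
    using reduced_word_exists[of "word_value W ss"] assms by auto
  thus ?thesis using word_value_eq_iff[of ss ts] presentation_eq_parity[of "positive_word ss" "positive_word ts"] assms by simp
qed

lemma len_mult_generator:
  assumes "g \<in> carrier W" "s \<in> S"
  shows "len (g \<otimes> s) = Suc (len g) \<or> len g = Suc (len (g \<otimes> s))"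
proof -
  obtain ss where ss: "ss \<in> lists S" "word_value W ss = g" "length ss = len g"
    using reduced_word_exists[OF assms(1)] .
  have "even (len (g \<otimes> s)) \<noteq> even (len g)"
    using word_parity[of "ss @ [s]"] word_parity[of ss] ss assms
    by (simp add: word_value_append S_carrier)
  moreover have "len s \<le> 1" using len_word_le[of "[s]"] assms by (simp add: S_carrier)
  moreover have "len (g \<otimes> s) \<le> len g + len s" using assms S_carrier by (simp add: len_mult_le)
  moreover have "g \<otimes> s \<otimes> s = g" using assms by (simp add: m_assoc S_carrier generator_square)
  hence "len g \<le> len (g \<otimes> s) + len s"
    using len_mult_le[of "g \<otimes> s" s] assms S_carrier by simp
  ultimately show ?thesis by presburger
qed

lemma descent_exists:
  assumes "g \<in> carrier W" "len g \<noteq> 0"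
  obtains s where "s \<in> S" "len g = Suc (len (g \<otimes> s))"
proof -
  obtain ss where ss: "ss \<in> lists S" "word_value W ss = g" "length ss = len g"
    using reduced_word_exists[OF assms(1)] .
  then obtain ts s where eq: "ss = ts @ [s]" using assms(2) by (cases ss rule: rev_cases) auto
  have S: "ts \<in> lists S" "s \<in> S" using ss eq by auto
  have "g \<otimes> s = word_value W ts"
    using S unfolding ss(2)[symmetric] eq
    by (simp add: word_value_append m_assoc S_carrier generator_square)
  hence "len (g \<otimes> s) < len g" using len_word_le[OF S(1)] ss(3) eq by simp
  thus ?thesis using len_mult_generator[OF assms(1) S(2)] that S(2) by auto
qed

section \<open>The geometric representation\<close>

text \<open>On vectors supported in \<open>S\<close> this is \<open>B(v, \<alpha>\<^sub>s)\<close>. Summing over \<open>S\<close> rather than over supports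
  makes it, and hence the reflections below, linear on all functions, so that no support
  conditions have to be carried through the computations.\<close>
definition pairing :: "'a \<Rightarrow> ('a \<Rightarrow> real) \<Rightarrow> real" where
  "pairing s v = (\<Sum>u\<in>S. v u * simple_form m u s)"

definition reflect :: "'a \<Rightarrow> ('a \<Rightarrow> real) \<Rightarrow> 'a \<Rightarrow> real" where
  "reflect s v = (\<lambda>t. v t - 2 * pairing s v * simple_root s t)"

lemma simple_form_sym: "s \<in> S \<Longrightarrow> t \<in> S \<Longrightarrow> simple_form m s t = simple_form m t s"
  by (simp add: simple_form_def m_sym)

lemma simple_form_diag: "s \<in> S \<Longrightarrow> simple_form m s s = 1"
  by (simp add: simple_form_def m_diag one_enat_def)

lemma sum_simple_root: "s \<in> S \<Longrightarrow> (\<Sum>t\<in>S. simple_root s t * h t) = h s"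
  using finite_S by (simp add: simple_root_def if_distribR if_distrib sum.delta cong: if_cong)

lemma pairing_simple: "t \<in> S \<Longrightarrow> pairing s (simple_root t) = simple_form m t s"
  by (simp add: pairing_def sum_simple_root)

lemma pairing_comb: "pairing s (\<lambda>x. a * u x + b * v x) = a * pairing s u + b * pairing s v"
  by (simp add: pairing_def sum.distrib sum_distrib_left algebra_simps)

lemma reflect_comb:
  "reflect s (\<lambda>x. a * u x + b * v x) = (\<lambda>x. a * reflect s u x + b * reflect s v x)"
  by (simp add: reflect_def pairing_comb algebra_simps)

lemma pairing_reflect: "t \<in> S \<Longrightarrow> pairing s (reflect t v) = pairing s v - 2 * pairing t v * simple_form m t s"
  using pairing_comb[of s 1 v "- 2 * pairing t v" "simple_root t"]
  by (simp add: reflect_def pairing_simple)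

lemma reflect_reflect: "s \<in> S \<Longrightarrow> reflect s (reflect s v) = v"
  by (rule ext) (subst reflect_def, simp add: pairing_reflect simple_form_diag, simp add: reflect_def)

lemma reflect_simple_self: "s \<in> S \<Longrightarrow> reflect s (simple_root s) = (\<lambda>x. - simple_root s x)"
  by (simp add: reflect_def pairing_simple simple_form_diag)

definition word_act :: "'a list \<Rightarrow> ('a \<Rightarrow> real) \<Rightarrow> 'a \<Rightarrow> real" where
  "word_act ss = foldr reflect ss"

lemma word_act_simps [simp]:
  "word_act [] v = v" "word_act (s # ss) v = reflect s (word_act ss v)"
  "word_act (ss @ ts) v = word_act ss (word_act ts v)"
  by (auto simp: word_act_def)

lemma word_act_comb:
  "word_act ss (\<lambda>x. a * u x + b * v x) = (\<lambda>x. a * word_act ss u x + b * word_act ss v x)"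
  by (induction ss) (auto simp: reflect_comb)

text \<open>Each further reflection replaces the coordinates \<open>(a, b)\<close> by \<open>(2ca - b, a)\<close> with
  \<open>c = -B(\<alpha>\<^sub>s, \<alpha>\<^sub>t)\<close>, which is the Chebyshev recursion.\<close>
lemma alt_word_act_simple:
  assumes "s \<in> S" "t \<in> S"
  shows "word_act (alt_word s t k) (simple_root s) =
    (\<lambda>x. cheb (- simple_form m s t) (Suc k) * simple_root (if even k then s else t) x +
         cheb (- simple_form m s t) k * simple_root (if even k then t else s) x)"
proof (induction k)
  case (Suc k)
  let ?c = "- simple_form m s t"
  have R: "reflect q (\<lambda>x. a * simple_root p x + b * simple_root q x) =
      (\<lambda>x. (2 * ?c * a - b) * simple_root q x + a * simple_root p x)"
    if "{p, q} = {s, t}" for p q a b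
  proof -
    have pq: "p \<in> S" "q \<in> S" "simple_form m p q = simple_form m s t"
      using that assms simple_form_sym[OF assms] by (auto simp: doubleton_eq_iff)
    show ?thesis
      by (simp add: reflect_comb reflect_simple_self pq)
        (simp add: reflect_def pairing_simple pq algebra_simps)
  qed
  show ?case
    unfolding alt_word_Cons word_act_simps Suc.IH
    using R[of s t] R[of t s] by (cases "even k") (auto simp: insert_commute)
qed simp

lemma word_act_fixed:
  assumes "\<And>s. s \<in> set ss \<Longrightarrow> pairing s v = 0"
  shows "word_act ss v = v"
  using assms by (induction ss) (auto simp: reflect_def)

text \<open>For \<open>s \<noteq> t\<close> the form is nondegenerate on the plane of \<open>\<alpha>\<^sub>s\<close> and \<open>\<alpha>\<^sub>t\<close> when \<open>n\<close> is finite, so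
  every vector is a sum of one orthogonal to the plane, fixed by both reflections, and one in the
  plane, where the explicit coordinates show that the rotation has returned to its start.\<close>
lemma dihedral_relation_act:
  assumes "s \<in> S" "t \<in> S" "m s t = enat n"
  shows "word_act (alt_word s t (2 * n)) v = v"
proof (cases "s = t")
  case True
  then have "n = 1" using assms m_diag by (auto simp: one_enat_def)
  thus ?thesis using True assms by (simp add: numeral_2_eq_2 reflect_reflect)
next
  case False
  hence n: "2 \<le> n" using m_ge[of s t] assms by (simp add: numeral_eq_enat)
  \<comment> \<open>\<open>a\<close> and \<open>b\<close> are the coordinates of the orthogonal projection of \<open>v\<close> to the plane,
    by Cramer's rule for the Gram matrix with determinant \<open>d\<close>.\<close>
  define c where "c = cos (pi / real n)"
  define d where "d = 1 - c\<^sup>2"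
  define a where "a = (pairing s v + c * pairing t v) / d"
  define b where "b = (pairing t v + c * pairing s v) / d"
  define w where "w = (\<lambda>x. 1 * v x + (- 1) * (a * simple_root s x + b * simple_root t x))"
  have "d = (sin (pi / real n))\<^sup>2" by (simp add: d_def c_def sin_squared_eq)
  hence d: "d \<noteq> 0" using sin_pi_div_pos[OF n] by simp
  have st: "simple_form m s t = - c" "simple_form m t s = - c"
    using simple_form_sym[OF assms(1,2)] assms(3) by (auto simp: simple_form_def c_def)
  have ab: "a - c * b = pairing s v" "b - c * a = pairing t v"
  proof -
    have "(a - c * b) * d = pairing s v * d" "(b - c * a) * d = pairing t v * d"
      using d by (simp_all add: a_def b_def field_simps) (simp_all add: d_def algebra_simps power2_eq_square)
    thus "a - c * b = pairing s v" "b - c * a = pairing t v" using d by auto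
  qed
  have "pairing s w = 0" "pairing t w = 0"
    using ab assms unfolding w_def pairing_comb
    by (simp_all add: pairing_simple st simple_form_diag algebra_simps)
  moreover have "set (alt_word s t (2 * n)) \<subseteq> {s, t}"
    using alt_word_in_lists[of s "{s,t}" t "2*n"] by auto
  ultimately have w: "word_act (alt_word s t (2 * n)) w = w"
    by (intro word_act_fixed) auto
  have s: "word_act (alt_word s t (2 * n)) (simple_root s) = simple_root s"
    using cheb_cos_period[OF n] by (simp add: alt_word_act_simple assms st c_def)
  have "word_act (alt_word t s (2 * n - 1)) (simple_root t) = (\<lambda>x. - simple_root t x)"
    using n cheb_cos_period[OF n] by (simp add: alt_word_act_simple assms st c_def)
  moreover have "alt_word s t (2 * n) = alt_word t s (2 * n - 1) @ [t]"
    using n by (cases "2 * n") auto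
  ultimately have t: "word_act (alt_word s t (2 * n)) (simple_root t) = simple_root t"
    using word_act_comb[of "alt_word t s (2 * n - 1)" "- 1" "simple_root t" 0 "simple_root t"]
    by (simp add: reflect_simple_self assms)
  have v: "v = (\<lambda>x. 1 * w x + 1 * (a * simple_root s x + b * simple_root t x))"
    by (simp add: w_def)
  show ?thesis
    by (subst (1 2) v) (simp only: word_act_comb w s t)
qed

lemma presentation_eq_act:
  assumes "presentation_eq S (coxeter_relators S m) u v"
  shows "word_act (map fst u) = word_act (map fst v)"
  using assms
proof (induction rule: presentation_eq.induct)
  case (relator u v r)
  then obtain s t n where "s \<in> S" "t \<in> S" "m s t = enat n"
    "r = concat (replicate n [(s, True), (t, True)])"
    by (auto simp: coxeter_relators_def)
  moreover from this have "map fst r = alt_word s t (2 * n)"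
    by (simp add: concat_replicate_alt_word[symmetric] map_concat)
  ultimately show ?case by (auto simp: dihedral_relation_act)
qed (auto simp: reflect_reflect)

text \<open>The same choice of word as in the given action, but with the linear reflections; the two
  agree on vectors supported in \<open>S\<close>, in particular on roots.\<close>
definition act :: "'a \<Rightarrow> ('a \<Rightarrow> real) \<Rightarrow> 'a \<Rightarrow> real" where
  "act g = word_act (SOME ss. ss \<in> lists S \<and> word_value W ss = g)"

lemma act_word:
  assumes "ss \<in> lists S"
  shows "act (word_value W ss) = word_act ss"
proof -
  define ts where "ts = (SOME ts. ts \<in> lists S \<and> word_value W ts = word_value W ss)"
  have ts: "ts \<in> lists S \<and> word_value W ts = word_value W ss"
    unfolding ts_def by (rule someI[of _ ss]) (use assms in auto)
  hence "word_act (map fst (positive_word ts)) = word_act (map fst (positive_word ss))"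
    using word_value_eq_iff[of ts ss] assms by (intro presentation_eq_act) auto
  thus ?thesis by (simp add: act_def ts_def[symmetric] comp_def)
qed

lemma act_mult:
  assumes "g \<in> carrier W" "h \<in> carrier W"
  shows "act (g \<otimes> h) v = act g (act h v)"
  using word_exists[OF assms(1)] word_exists[OF assms(2)]
  by (metis act_word append_in_lists_conv word_act_simps(3) word_value_append)

lemma act_one [simp]: "act \<one> v = v"
  using act_word[of "[]"] by simp

lemma act_generator: "s \<in> S \<Longrightarrow> act s = reflect s"
  using act_word[of "[s]"] by (simp add: S_carrier fun_eq_iff)

lemma act_comb: "act g (\<lambda>x. a * u x + b * v x) = (\<lambda>x. a * act g u x + b * act g v x)"
  by (simp add: act_def word_act_comb)

lemma act_uminus: "act g (\<lambda>x. - v x) = (\<lambda>x. - act g v x)"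
  using act_comb[of g "- 1" v 0 v] by simp

lemma act_inv_act: "g \<in> carrier W \<Longrightarrow> act (inv g) (act g v) = v"
  using act_mult[of "inv g" g v] by simp

lemma act_act_inv: "g \<in> carrier W \<Longrightarrow> act g (act (inv g) v) = v"
  using act_mult[of g "inv g" v] by simp

section \<open>Descents and the sign of a root\<close>

text \<open>Induction on length. If \<open>g \<noteq> 1\<close>, then \<open>g\<close> has a descent \<open>t \<noteq> s\<close>; split off from the right the
  longest alternating word in \<open>s\<close> and \<open>t\<close> ending in \<open>t\<close> that still leaves lengths additive:
  \<open>g = va\<close>. The letter that would prolong \<open>a\<close> on the left is an ascent of \<open>v\<close> by maximality, the first
  letter of \<open>a\<close> is one because lengths add up, so \<open>v\<close> maps \<open>\<alpha>\<^sub>s\<close> and \<open>\<alpha>\<^sub>t\<close> to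
  nonnegative vectors. Since \<open>s\<close> is an ascent of \<open>g\<close>, a braid move shows that the word \<open>a\<close> is shorter than \<open>m(s,t)\<close>, and so
  \<open>a(\<alpha>\<^sub>s)\<close> has nonnegative Chebyshev coordinates.\<close>
theorem ascent_nonneg:
  assumes "g \<in> carrier W" "s \<in> S" "len g < len (g \<otimes> s)"
  shows "0 \<le> act g (simple_root s) x"
  using assms
proof (induction "len g" arbitrary: g s rule: less_induct)
  case less
  show ?case
  proof (cases "len g = 0")
    case True
    thus ?thesis using less.prems by (simp add: len_eq_0_iff simple_root_def)
  next
    case False
    obtain t where t: "t \<in> S" "len g = Suc (len (g \<otimes> t))"
      using descent_exists[OF less.prems(1) False] .
    have st: "s \<noteq> t" using t less.prems by auto
    note sS = less.prems(2)
    note [simp] = alt_word_in_lists[OF sS t(1)] alt_word_in_lists[OF t(1) sS] S_carrier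
    define P where "P k \<longleftrightarrow> (\<exists>v \<in> carrier W. g = v \<otimes> word_value W (alt_word s t k) \<and> len v + k = len g)" for k
    define k where "k = (GREATEST k. P k)"
    have bound: "j \<le> len g" if "P j" for j using that by (auto simp: P_def)
    have "P 1"
      unfolding P_def using t less.prems(1)
      by (intro bexI[of _ "g \<otimes> t"]) (auto simp: m_assoc generator_square)
    hence k: "P k" "k \<ge> 1" "\<And>j. P j \<Longrightarrow> j \<le> k"
      unfolding k_def using bound by (auto intro: GreatestI_nat Greatest_le_nat)
    then obtain v where v: "v \<in> carrier W" "g = v \<otimes> word_value W (alt_word s t k)" "len v + k = len g"
      by (auto simp: P_def)
    let ?a = "\<lambda>j. word_value W (alt_word s t j)"
    \<comment> \<open>The split-off word begins with \<open>?p\<close>, and \<open>?q\<close> would prolong it on the left.\<close>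
    let ?p = "if even k then s else t" and ?q = "if even k then t else s"
    have pq: "?p \<in> S" "?q \<in> S" using sS t by auto
    have "len v < len (v \<otimes> ?q)"
    proof (rule ccontr)
      assume "\<not> ?thesis"
      hence "len v = Suc (len (v \<otimes> ?q))" using len_mult_generator[OF v(1) pq(2)] by auto
      moreover have "v \<otimes> ?q \<otimes> ?a (Suc k) = v \<otimes> (?q \<otimes> ?q) \<otimes> ?a k"
        unfolding alt_word_Cons word_value_Cons using v pq by (simp add: m_assoc)
      ultimately have "P (Suc k)"
        unfolding P_def using v pq
        by (intro bexI[of _ "v \<otimes> ?q"]) (auto simp: generator_square simp del: alt_word.simps)
      with k(3) show False by fastforce
    qed
    moreover have "len v < len (v \<otimes> ?p)"
    proof -
      obtain j where j: "k = Suc j" using k(2) by (cases k) auto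
      have "g = (v \<otimes> ?p) \<otimes> ?a j"
        using v pq j alt_word_Cons[of s t j] by (simp add: m_assoc del: alt_word.simps split: if_splits)
      hence "len g \<le> len (v \<otimes> ?p) + j"
        using len_mult_word_le[of "v \<otimes> ?p" "alt_word s t j"] v(1) pq by simp
      thus ?thesis using v j by simp
    qed
    ultimately have pos: "0 \<le> act v (simple_root ?p) x" "0 \<le> act v (simple_root ?q) x"
      using less.hyps[of v] v k(2) pq by auto
    have cheb: "0 \<le> cheb (- simple_form m s t) (Suc k) \<and> 0 \<le> cheb (- simple_form m s t) k"
    proof (cases "m s t")
      case infinity
      thus ?thesis by (simp only: simple_form_def enat.case minus_minus cheb_one) simp
    next
      case (enat n)
      hence n: "2 \<le> n" using m_ge[of s t] sS t(1) st by (simp add: numeral_eq_enat)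
      \<comment> \<open>Otherwise a braid move makes the word end in \<open>s\<close>, and \<open>s\<close> would be a descent of \<open>g\<close>.\<close>
      have "k < n"
      proof (rule ccontr)
        assume "\<not> k < n"
        then obtain i where i: "k = i + n" by (metis add.commute le_add_diff_inverse not_less)
        define Y where "Y = (if even n then alt_word s t i else alt_word t s i)"
        have Y: "Y \<in> lists S" "length Y = i" by (auto simp: Y_def)
        obtain j where j: "n = Suc j" using n by (cases n) auto
        have "?a k = word_value W Y \<otimes> word_value W (alt_word t s n)"
          using alt_word_add[of s t i n] Y braid_relation[OF sS t(1) enat]
          by (simp add: i Y_def word_value_append)
        also have "\<dots> = word_value W Y \<otimes> (?a j \<otimes> s)"
          using j sS by (simp add: word_value_append)
        finally have "g \<otimes> s = v \<otimes> word_value W (Y @ alt_word s t j)"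
          using v Y sS by (simp add: m_assoc generator_square word_value_append)
        hence "len (g \<otimes> s) \<le> len v + (i + j)"
          using len_mult_word_le[of v "Y @ alt_word s t j"] v(1) Y by simp
        thus False using v(3) i j less.prems(3) by simp
      qed
      thus ?thesis using cheb_cos_nonneg[OF n] enat by (simp add: simple_form_def)
    qed
    have "act g (simple_root s) = act v (word_act (alt_word s t k) (simple_root s))"
      using v by (simp add: act_mult act_word)
    also have "\<dots> = (\<lambda>x. cheb (- simple_form m s t) (Suc k) * act v (simple_root ?p) x +
         cheb (- simple_form m s t) k * act v (simple_root ?q) x)"
      by (simp only: alt_word_act_simple[OF sS t(1)] act_comb)
    finally show ?thesis using cheb pos by simp
  qed
qed


section \<open>Positive and negative roots\<close>

lemma simple_reflection_eq:
  assumes "s \<in> S" "\<And>x. x \<notin> S \<Longrightarrow> v x = 0"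
  shows "simple_reflection m s v = reflect s v"
proof -
  have "{t. simple_root s t \<noteq> 0} = {s}" by (auto simp: simple_root_def)
  hence "cox_form m v (simple_root s) = (\<Sum>u | v u \<noteq> 0. v u * simple_form m u s)"
    by (simp add: cox_form_def simple_root_def)
  also have "\<dots> = pairing s v"
    unfolding pairing_def using assms(2) finite_S by (intro sum.mono_neutral_left) auto
  finally show ?thesis by (simp add: simple_reflection_def reflect_def)
qed

lemma word_act_support:
  assumes "ss \<in> lists S" "\<And>x. x \<notin> S \<Longrightarrow> v x = 0" "x \<notin> S"
  shows "word_act ss v x = 0"
  using assms by (induction ss arbitrary: x) (auto simp: reflect_def simple_root_def)

lemma foldr_simple_reflection:
  assumes "ss \<in> lists S" "\<And>x. x \<notin> S \<Longrightarrow> v x = 0"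
  shows "foldr (simple_reflection m) ss v = word_act ss v"
  using assms(1)
proof (induction ss)
  case (Cons s ss)
  then have "s \<in> S" "ss \<in> lists S" by auto
  with Cons.IH show ?case
    using simple_reflection_eq[of s "word_act ss v"] word_act_support[OF _ assms(2), of ss] by simp
qed simp

lemma act_support:
  assumes "g \<in> carrier W" "\<And>x. x \<notin> S \<Longrightarrow> v x = 0" "x \<notin> S"
  shows "act g v x = 0"
proof -
  obtain ss where "ss \<in> lists S" "word_value W ss = g" using word_exists[OF assms(1)] by blast
  thus ?thesis using word_act_support[of ss v x] assms(2,3) by (metis act_word)
qed

lemma cox_act_eq:
  assumes "g \<in> carrier W" "\<And>x. x \<notin> S \<Longrightarrow> v x = 0"
  shows "cox_act W S m g v = act g v"
proof -
  define ts where "ts = (SOME ts. ts \<in> lists S \<and> word_value W ts = g)"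
  have "ts \<in> lists S \<and> word_value W ts = g"
    unfolding ts_def by (rule someI_ex) (use word_exists[OF assms(1)] in auto)
  thus ?thesis
    using foldr_simple_reflection[of ts v] assms(2) by (simp add: cox_act_def act_def ts_def)
qed

lemma cox_act_simple_root:
  "g \<in> carrier W \<Longrightarrow> s \<in> S \<Longrightarrow> cox_act W S m g (simple_root s) = act g (simple_root s)"
  by (rule cox_act_eq) (auto simp: simple_root_def)

abbreviation \<Phi> where "\<Phi> \<equiv> roots W S m"
abbreviation \<Phi>p where "\<Phi>p \<equiv> positive_roots W S m"
abbreviation \<Phi>n where "\<Phi>n \<equiv> negative_roots W S m"
abbreviation Inv where "Inv \<equiv> inversion_set W S m"

lemma root_iff: "\<beta> \<in> \<Phi> \<longleftrightarrow> (\<exists>g \<in> carrier W. \<exists>s \<in> S. \<beta> = act g (simple_root s))"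
  unfolding roots_def mem_Collect_eq by (metis cox_act_simple_root)

lemma root_support: "\<beta> \<in> \<Phi> \<Longrightarrow> x \<notin> S \<Longrightarrow> \<beta> x = 0"
  unfolding root_iff by (auto intro!: act_support simp: simple_root_def)

lemma cox_act_root: "g \<in> carrier W \<Longrightarrow> \<beta> \<in> \<Phi> \<Longrightarrow> cox_act W S m g \<beta> = act g \<beta>"
  by (rule cox_act_eq) (auto simp: root_support)

lemma root_act: "g \<in> carrier W \<Longrightarrow> \<beta> \<in> \<Phi> \<Longrightarrow> act g \<beta> \<in> \<Phi>"
  unfolding root_iff by (metis act_mult m_closed)

lemma positive_root_iff: "\<beta> \<in> \<Phi>p \<longleftrightarrow> \<beta> \<in> \<Phi> \<and> (\<forall>x. 0 \<le> \<beta> x)"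
  by (auto simp: positive_roots_def)

lemma positive_root_root: "\<beta> \<in> \<Phi>p \<Longrightarrow> \<beta> \<in> \<Phi>"
  by (simp add: positive_root_iff)

lemma negative_root_iff: "\<beta> \<in> \<Phi>n \<longleftrightarrow> (\<lambda>x. - \<beta> x) \<in> \<Phi>p"
  by (force simp: negative_roots_def image_iff)

lemma simple_root_positive: "s \<in> S \<Longrightarrow> simple_root s \<in> \<Phi>p"
  unfolding positive_root_iff root_iff by (metis act_one one_closed simple_root_def order_refl zero_le_one)

lemma ascent_positive:
  "g \<in> carrier W \<Longrightarrow> s \<in> S \<Longrightarrow> len g < len (g \<otimes> s) \<Longrightarrow> act g (simple_root s) \<in> \<Phi>p"
  unfolding positive_root_iff root_iff using ascent_nonneg by blast

lemma act_mult_generator_root: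
  "g \<in> carrier W \<Longrightarrow> s \<in> S \<Longrightarrow> act (g \<otimes> s) (simple_root s) = (\<lambda>x. - act g (simple_root s) x)"
  by (simp add: act_mult S_carrier act_generator reflect_simple_self act_uminus)

lemma descent_negative:
  assumes "g \<in> carrier W" "s \<in> S" "len (g \<otimes> s) < len g"
  shows "act g (simple_root s) \<in> \<Phi>n"
  using ascent_positive[of "g \<otimes> s" s] act_mult_generator_root[OF assms(1,2)] assms
  by (simp add: negative_root_iff m_assoc S_carrier generator_square)

lemma root_sign: "\<beta> \<in> \<Phi> \<Longrightarrow> \<beta> \<in> \<Phi>p \<or> \<beta> \<in> \<Phi>n"
  unfolding root_iff[of \<beta>] using len_mult_generator ascent_positive descent_negative
  by (metis lessI)

lemma root_nonzero: "\<beta> \<in> \<Phi> \<Longrightarrow> \<beta> \<noteq> (\<lambda>x. 0)"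
proof
  assume "\<beta> \<in> \<Phi>" "\<beta> = (\<lambda>x. 0)"
  then obtain g s where gs: "g \<in> carrier W" "act g (simple_root s) = (\<lambda>x. 0)"
    by (auto simp: root_iff)
  have "simple_root s = act (inv g) (\<lambda>x. 0)" using act_inv_act[OF gs(1)] gs(2) by metis
  also have "\<dots> = (\<lambda>x. 0)" using act_comb[of "inv g" 0 "\<lambda>x. 0" 0 "\<lambda>x. 0"] by simp
  finally show False by (auto simp: simple_root_def fun_eq_iff split: if_splits)
qed

lemma not_positive_and_negative: "\<beta> \<in> \<Phi>p \<Longrightarrow> \<beta> \<notin> \<Phi>n"
  using root_nonzero[of \<beta>] unfolding negative_root_iff positive_root_iff
  by (auto intro!: ext antisym)

lemma uminus_positive_root: "\<beta> \<in> \<Phi>p \<Longrightarrow> (\<lambda>x. - \<beta> x) \<in> \<Phi>n"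
  by (simp add: negative_root_iff)

text \<open>On vectors supported in \<open>S\<close> this is \<open>B(v, v)\<close>. All roots have norm one, so \<open>\<alpha>\<^sub>s\<close> is the only positive root
  proportional to \<open>\<alpha>\<^sub>s\<close>.\<close>
definition norm_form :: "('a \<Rightarrow> real) \<Rightarrow> real" where
  "norm_form v = (\<Sum>t\<in>S. v t * pairing t v)"

lemma norm_form_reflect:
  assumes "s \<in> S"
  shows "norm_form (reflect s v) = norm_form v"
proof -
  let ?c = "pairing s v"
  have 1: "(\<Sum>t\<in>S. v t * simple_form m s t) = ?c"
    unfolding pairing_def by (rule sum.cong) (auto simp: simple_form_sym assms)
  have "norm_form (reflect s v) =
      (\<Sum>t\<in>S. v t * pairing t v - 2 * ?c * (v t * simple_form m s t)
        - 2 * ?c * (simple_root s t * (pairing t v - 2 * ?c * simple_form m s t)))"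
    unfolding norm_form_def pairing_reflect[OF assms]
    by (rule sum.cong) (auto simp: reflect_def algebra_simps)
  also have "\<dots> = norm_form v - 2 * ?c * ?c - 2 * ?c * (?c - 2 * ?c * simple_form m s s)"
    by (simp only: sum_subtractf sum_distrib_left[symmetric] 1 sum_simple_root[OF assms] norm_form_def)
  finally show ?thesis by (simp add: simple_form_diag assms)
qed

lemma norm_form_root:
  assumes "\<beta> \<in> \<Phi>"
  shows "norm_form \<beta> = 1"
proof -
  have inv: "norm_form (word_act ss v) = norm_form v" if "ss \<in> lists S" for ss v
    using that by (induction ss) (auto simp: norm_form_reflect)
  obtain g s where gs: "g \<in> carrier W" "s \<in> S" "\<beta> = act g (simple_root s)"
    using assms by (auto simp: root_iff)
  have "norm_form \<beta> = norm_form (simple_root s)"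
    using word_exists[OF gs(1)] inv gs(3) by (metis act_word)
  also have "\<dots> = 1"
    using gs(2) by (simp add: norm_form_def sum_simple_root pairing_simple simple_form_diag)
  finally show ?thesis .
qed

text \<open>Reflection in \<open>\<alpha>\<^sub>s\<close> changes only the coordinate at \<open>s\<close>, so a positive root that becomes
  negative has no other nonzero coordinate.\<close>
lemma reflect_positive_root:
  assumes "s \<in> S" "\<beta> \<in> \<Phi>p" "reflect s \<beta> \<in> \<Phi>n"
  shows "\<beta> = simple_root s"
proof -
  have z: "\<beta> x = 0" if "x \<noteq> s" for x
  proof -
    have "0 \<le> - reflect s \<beta> x" "0 \<le> \<beta> x"
      using assms by (auto simp: negative_root_iff positive_root_iff)
    thus ?thesis using that by (simp add: reflect_def simple_root_def)
  qed
  hence b: "\<beta> = (\<lambda>x. \<beta> s * simple_root s x + 0 * simple_root s x)"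
    by (auto simp: simple_root_def)
  have "pairing s \<beta> = \<beta> s"
    using pairing_comb[of s "\<beta> s" "simple_root s" 0 "simple_root s"] assms(1)
    unfolding b[symmetric] by (simp add: pairing_simple simple_form_diag)
  moreover have "norm_form \<beta> = \<beta> s * pairing s \<beta>"
    unfolding norm_form_def using finite_S assms(1) z
    by (subst sum.remove[of S s]) auto
  ultimately have "\<beta> s * \<beta> s = 1"
    using norm_form_root[of \<beta>] assms(2) by (simp add: positive_root_root)
  moreover have "0 \<le> \<beta> s" using assms(2) by (simp add: positive_root_iff)
  ultimately have "\<beta> s = 1" by (metis abs_of_nonneg abs_1 abs_mult_self_eq power2_eq_square power2_eq_iff_nonneg zero_le_one mult_1)
  with z show ?thesis by (auto simp: simple_root_def)
qed

section \<open>Inversion sets\<close>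

lemma inversion_iff:
  "g \<in> carrier W \<Longrightarrow> \<beta> \<in> Inv g \<longleftrightarrow> \<beta> \<in> \<Phi>p \<and> act (inv g) \<beta> \<in> \<Phi>n"
  by (auto simp: inversion_set_def cox_act_root positive_root_root)

lemma not_inversion_iff:
  assumes "g \<in> carrier W" "\<beta> \<in> \<Phi>p"
  shows "\<beta> \<notin> Inv g \<longleftrightarrow> act (inv g) \<beta> \<in> \<Phi>p"
  using assms root_sign[of "act (inv g) \<beta>"] not_positive_and_negative
  by (auto simp: inversion_iff root_act positive_root_root)

text \<open>Appending \<open>s\<close> to \<open>g\<close> applies one more reflection to \<open>g\<^bsup>-1\<^esup>(\<beta>)\<close>, and that changes its sign only
  for \<open>g\<^bsup>-1\<^esup>(\<beta>) = \<plusminus>\<alpha>\<^sub>s\<close>; the minus sign is excluded because \<open>g(\<alpha>\<^sub>s)\<close> is positive.\<close>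
lemma inversion_set_ascent:
  assumes "g \<in> carrier W" "s \<in> S" "len g < len (g \<otimes> s)"
  shows "Inv (g \<otimes> s) = insert (act g (simple_root s)) (Inv g)"
    and "act g (simple_root s) \<notin> Inv g"
proof -
  let ?\<gamma> = "act g (simple_root s)"
  have pos: "?\<gamma> \<in> \<Phi>p" using ascent_positive[OF assms] .
  have act: "act (inv (g \<otimes> s)) \<beta> = reflect s (act (inv g) \<beta>)" for \<beta>
    using assms by (simp add: inv_mult_group S_carrier generator_inv act_mult act_generator)
  have sref: "reflect s (simple_root s) \<in> \<Phi>n"
    using assms by (simp add: reflect_simple_self uminus_positive_root simple_root_positive)
  show nin: "?\<gamma> \<notin> Inv g"
    using assms pos by (simp add: not_inversion_iff act_inv_act simple_root_positive)
  have "\<beta> \<in> Inv (g \<otimes> s) \<longleftrightarrow> \<beta> = ?\<gamma> \<or> \<beta> \<in> Inv g" if b: "\<beta> \<in> \<Phi>p" for \<beta>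
  proof (cases "\<beta> \<in> Inv g")
    case False
    hence p: "act (inv g) \<beta> \<in> \<Phi>p" using b assms by (simp add: not_inversion_iff)
    have "\<beta> \<in> Inv (g \<otimes> s) \<longleftrightarrow> reflect s (act (inv g) \<beta>) \<in> \<Phi>n"
      using assms b by (simp add: inversion_iff act S_carrier)
    also have "\<dots> \<longleftrightarrow> act (inv g) \<beta> = simple_root s"
      using reflect_positive_root[OF assms(2) p] sref by auto
    also have "\<dots> \<longleftrightarrow> \<beta> = ?\<gamma>" using assms act_inv_act act_act_inv by metis
    finally show ?thesis using False by simp
  next
    case True
    let ?\<delta> = "\<lambda>x. - act (inv g) \<beta> x"
    have d: "?\<delta> \<in> \<Phi>p" using True assms by (simp add: inversion_iff negative_root_iff)
    have rd: "reflect s ?\<delta> = (\<lambda>x. - reflect s (act (inv g) \<beta>) x)"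
      using reflect_comb[of s "- 1" "act (inv g) \<beta>" 0 "act (inv g) \<beta>"] by simp
    have "?\<delta> \<noteq> simple_root s"
    proof
      assume "?\<delta> = simple_root s"
      hence "act (inv g) \<beta> = (\<lambda>x. - simple_root s x)" by (metis minus_minus)
      hence "\<beta> = (\<lambda>x. - ?\<gamma> x)" using assms act_act_inv act_uminus by metis
      thus False using b pos not_positive_and_negative uminus_positive_root by metis
    qed
    hence "reflect s ?\<delta> \<notin> \<Phi>n" using reflect_positive_root[OF assms(2) d] by blast
    moreover have "reflect s ?\<delta> \<in> \<Phi>"
      using root_act[of s ?\<delta>] d assms by (simp add: act_generator S_carrier positive_root_root)
    ultimately have "reflect s ?\<delta> \<in> \<Phi>p" using root_sign by blast
    hence "\<beta> \<in> Inv (g \<otimes> s)"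
      using assms b by (simp add: inversion_iff act S_carrier rd negative_root_iff)
    thus ?thesis using True by simp
  qed
  moreover have "Inv g \<subseteq> \<Phi>p" "Inv (g \<otimes> s) \<subseteq> \<Phi>p" by (auto simp: inversion_set_def)
  ultimately show "Inv (g \<otimes> s) = insert ?\<gamma> (Inv g)" using pos by blast
qed

lemma inversion_set_one: "Inv \<one> = {}"
  using not_positive_and_negative by (auto simp: inversion_iff)

text \<open>Along a reduced word every letter is an ascent and adds one inversion.\<close>
theorem card_inversion_set:
  assumes "g \<in> carrier W"
  shows "finite (Inv g) \<and> card (Inv g) = len g"
  using assms
proof (induction "len g" arbitrary: g)
  case 0
  thus ?case by (simp add: len_eq_0_iff inversion_set_one)
next
  case (Suc n)
  obtain s where s: "s \<in> S" "len g = Suc (len (g \<otimes> s))"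
    using descent_exists[of g] Suc by (metis nat.distinct(1))
  let ?h = "g \<otimes> s"
  have h: "?h \<in> carrier W" "?h \<otimes> s = g"
    using s Suc.prems by (auto simp: S_carrier m_assoc generator_square)
  have "finite (Inv ?h) \<and> card (Inv ?h) = len ?h" using Suc s h by simp
  thus ?case using inversion_set_ascent[OF h(1) s(1)] s(2) by (simp add: h(2))
qed

text \<open>Sign changes of the two factors never cancel: if \<open>\<beta> \<in> \<Phi>\<^sub>w\<close>, then
  \<open>\<delta> = -w\<^bsup>-1\<^esup>(\<beta>)\<close> is positive with \<open>w(\<delta>) = -\<beta>\<close> negative, so \<open>\<delta> \<notin> \<Phi>\<^sub>x\<close> and \<open>x\<^bsup>-1\<^esup>\<close> does not undo the
  sign change. Hence \<open>\<Phi>\<^bsub>wx\<^esub> = \<Phi>\<^sub>w \<union> w(\<Phi>\<^sub>x)\<close>.\<close>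
lemma len_mult_of_positive:
  assumes "w \<in> carrier W" "x \<in> carrier W" "act w ` Inv x \<subseteq> \<Phi>p"
  shows "len (w \<otimes> x) = len w + len x"
proof -
  note g = assms(1,2)
  have act: "act (inv (w \<otimes> x)) \<beta> = act (inv x) (act (inv w) \<beta>)" for \<beta>
    using g by (simp add: inv_mult_group act_mult)
  have "Inv (w \<otimes> x) = Inv w \<union> act w ` Inv x"
  proof (intro equalityI subsetI)
    fix \<beta> assume b: "\<beta> \<in> Inv (w \<otimes> x)"
    hence bp: "\<beta> \<in> \<Phi>p" "act (inv x) (act (inv w) \<beta>) \<in> \<Phi>n" using g by (auto simp: inversion_iff act)
    show "\<beta> \<in> Inv w \<union> act w ` Inv x"
    proof (cases "\<beta> \<in> Inv w")
      case False
      hence "act (inv w) \<beta> \<in> Inv x"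
        using bp g not_inversion_iff[of w \<beta>] by (simp add: inversion_iff[of x])
      thus ?thesis using act_act_inv[OF g(1), of \<beta>] by (metis UnI2 imageI)
    qed simp
  next
    fix \<beta> assume "\<beta> \<in> Inv w \<union> act w ` Inv x"
    thus "\<beta> \<in> Inv (w \<otimes> x)"
    proof
      assume b: "\<beta> \<in> Inv w"
      let ?\<delta> = "\<lambda>x. - act (inv w) \<beta> x"
      have d: "\<beta> \<in> \<Phi>p" "?\<delta> \<in> \<Phi>p" using b g by (auto simp: inversion_iff negative_root_iff)
      have "act w ?\<delta> = (\<lambda>x. - \<beta> x)" using g by (simp add: act_uminus act_act_inv)
      hence "act w ?\<delta> \<notin> \<Phi>p" using d uminus_positive_root not_positive_and_negative by metis
      hence "?\<delta> \<notin> Inv x" using assms(3) by blast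
      hence "act (inv x) ?\<delta> \<in> \<Phi>p" using g d by (simp add: not_inversion_iff)
      thus ?thesis using g d by (simp add: inversion_iff act act_uminus negative_root_iff)
    next
      assume "\<beta> \<in> act w ` Inv x"
      thus ?thesis using assms by (auto simp: inversion_iff act act_inv_act)
    qed
  qed
  moreover have "Inv w \<inter> act w ` Inv x = {}"
    using g by (auto simp: inversion_iff act_inv_act dest: not_positive_and_negative)
  moreover have "inj_on (act w) (Inv x)" using act_inv_act[OF g(1)] by (metis inj_on_def)
  ultimately show ?thesis
    using card_inversion_set[of w] card_inversion_set[of x] card_inversion_set[of "w \<otimes> x"] g
    by (simp add: card_Un_disjoint card_image)
qed

section \<open>The longest element\<close>

lemma act_sum:
  assumes "finite F"
  shows "act g (\<lambda>x. \<Sum>s\<in>F. c s * f s x) = (\<lambda>x. \<Sum>s\<in>F. c s * act g (f s) x)"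
  using assms
proof (induction F)
  case empty
  show ?case using act_comb[of g 0 "\<lambda>x. 0" 0 "\<lambda>x. 0"] by simp
next
  case (insert s F)
  thus ?case using act_comb[of g "c s" "f s" 1 "\<lambda>x. \<Sum>s\<in>F. c s * f s x"] by simp
qed

lemma act_negative:
  assumes "g \<in> carrier W" "\<And>s. s \<in> S \<Longrightarrow> act g (simple_root s) \<in> \<Phi>n" "\<beta> \<in> \<Phi>p"
  shows "act g \<beta> \<in> \<Phi>n"
proof -
  have "\<beta> x = (\<Sum>s\<in>S. \<beta> s * simple_root s x)" for x
    using finite_S assms(3) root_support[of \<beta> x]
    by (simp add: simple_root_def positive_root_root if_distrib sum.delta' cong: if_cong)
  hence "\<beta> = (\<lambda>x. \<Sum>s\<in>S. \<beta> s * simple_root s x)" by (rule ext)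
  hence "act g \<beta> = (\<lambda>x. \<Sum>s\<in>S. \<beta> s * act g (simple_root s) x)"
    using act_sum[OF finite_S] by metis
  moreover have "0 \<le> \<beta> s" "0 \<le> - act g (simple_root s) x" if "s \<in> S" for s x
    using assms(2)[OF that] assms(3) by (auto simp: positive_root_iff negative_root_iff)
  ultimately have "act g \<beta> x \<le> 0" for x
    by (auto intro!: sum_nonpos simp: mult_nonneg_nonpos)
  moreover have "act g \<beta> \<in> \<Phi>" using assms by (simp add: root_act positive_root_root)
  ultimately show ?thesis
    using root_sign[of "act g \<beta>"] root_nonzero[of "act g \<beta>"]
    by (auto simp: positive_root_iff fun_eq_iff antisym)
qed

text \<open>Maximality makes every generator a descent of \<open>w\<^sub>0\<close>, so \<open>w\<^sub>0\<close> makes all simple roots negative,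
  hence all their nonnegative combinations.\<close>
lemma longest_act_negative:
  assumes "longest_element W S w0" "\<beta> \<in> \<Phi>p"
  shows "act w0 \<beta> \<in> \<Phi>n"
proof (rule act_negative[OF _ _ assms(2)])
  show w0: "w0 \<in> carrier W" using assms(1) by (simp add: longest_element_def)
  fix s assume s: "s \<in> S"
  have "len (w0 \<otimes> s) \<le> len w0"
    using assms(1) w0 S_carrier[OF s] by (simp add: longest_element_def)
  hence "len (w0 \<otimes> s) < len w0" using len_mult_generator[OF w0 s] by auto
  thus "act w0 (simple_root s) \<in> \<Phi>n" by (rule descent_negative[OF w0 s])
qed

lemma inversion_set_longest:
  assumes "longest_element W S w0"
  shows "Inv w0 = \<Phi>p"
proof -
  have w0: "w0 \<in> carrier W" using assms by (simp add: longest_element_def)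
  have "\<beta> \<in> Inv w0" if b: "\<beta> \<in> \<Phi>p" for \<beta>
  proof (rule ccontr)
    assume "\<beta> \<notin> Inv w0"
    hence "act (inv w0) \<beta> \<in> \<Phi>p" using w0 b not_inversion_iff by blast
    from longest_act_negative[OF assms this] show False
      using b w0 not_positive_and_negative by (simp add: act_act_inv)
  qed
  thus ?thesis by (auto simp: inversion_set_def)
qed

text \<open>The map \<open>\<beta> \<mapsto> -w\<^sub>0\<^bsup>-1\<^esup>(\<beta>)\<close> permutes the positive roots and carries the inversions of \<open>w\<^sub>0g\<close> to
  the positive roots that are not inversions of \<open>g\<close>.\<close>
lemma len_longest_mult:
  assumes "longest_element W S w0" "g \<in> carrier W"
  shows "len (w0 \<otimes> g) + len g = len w0"
proof -
  have w0: "w0 \<in> carrier W" using assms(1) by (simp add: longest_element_def)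
  have Invg: "Inv g \<subseteq> \<Phi>p" by (auto simp: inversion_set_def)
  define h where "h \<beta> = (\<lambda>x. - act w0 \<beta> x)" for \<beta>
  define k where "k \<beta> = (\<lambda>x. - act (inv w0) \<beta> x)" for \<beta>
  have hk: "h (k \<beta>) = \<beta>" "k (h \<beta>) = \<beta>" for \<beta>
    using w0 by (simp_all add: h_def k_def act_uminus act_inv_act act_act_inv)
  have kpos: "k \<beta> \<in> \<Phi>p" if "\<beta> \<in> \<Phi>p" for \<beta>
    using that inversion_iff[OF w0, of \<beta>] inversion_set_longest[OF assms(1)]
    by (simp add: k_def negative_root_iff)
  have hpos: "h \<beta> \<in> \<Phi>p" if "\<beta> \<in> \<Phi>p" for \<beta>
    using longest_act_negative[OF assms(1) that] by (simp add: h_def negative_root_iff)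
  have act: "act (inv (w0 \<otimes> g)) \<beta> = (\<lambda>x. - act (inv g) (k \<beta>) x)" for \<beta>
    using w0 assms(2) by (simp add: inv_mult_group act_mult k_def act_uminus)
  have "\<beta> \<in> Inv (w0 \<otimes> g) \<longleftrightarrow> \<beta> \<in> \<Phi>p \<and> k \<beta> \<in> \<Phi>p - Inv g" for \<beta>
    using w0 assms(2) kpos[of \<beta>] not_inversion_iff[OF assms(2), of "k \<beta>"]
    by (auto simp: inversion_iff[of "w0 \<otimes> g"] act negative_root_iff)
  hence "bij_betw k (Inv (w0 \<otimes> g)) (\<Phi>p - Inv g)"
    using hk hpos by (intro bij_betw_byWitness[of _ h]) auto
  hence "card (Inv (w0 \<otimes> g)) = card \<Phi>p - card (Inv g)"
    using card_inversion_set[OF assms(2)] Invg by (simp add: bij_betw_same_card card_Diff_subset)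
  moreover have "finite \<Phi>p" "card \<Phi>p = len w0"
    using card_inversion_set[OF w0] inversion_set_longest[OF assms(1)] by auto
  moreover have "card (Inv g) \<le> card \<Phi>p" using Invg \<open>finite \<Phi>p\<close> by (rule card_mono[rotated])
  ultimately show ?thesis using card_inversion_set w0 assms(2) by simp
qed

end

theorem proposition4p6:
  fixes W :: "('a, 'b) monoid_scheme" and S :: "'a set" and m :: "'a \<Rightarrow> 'a \<Rightarrow> enat"
    and w0 w x y :: 'a
  assumes "coxeter_system W S m"
    and "finite (carrier W)"
    and "longest_element W S w0"
    and "w \<in> carrier W" and "x \<in> carrier W" and "y \<in> carrier W"
    and "cox_act W S m w ` inversion_set W S m x = inversion_set W S m y"
  shows "right_divisor W S w (w0 \<otimes>\<^bsub>W\<^esub> inv\<^bsub>W\<^esub> x)"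
proof -
  have "S \<subseteq> carrier W" using assms(1) by (simp add: coxeter_system_def has_presentation_def)
  then interpret finite_rank_coxeter W S m
    using assms(1,2) finite_subset by unfold_locales blast+
  have w0: "w0 \<in> carrier W" using assms(3) by (simp add: longest_element_def)
  have "act w ` Inv x = Inv y"
    unfolding assms(7)[symmetric]
    by (rule image_cong) (auto simp: inversion_set_def cox_act_root positive_root_root assms(4))
  hence "act w ` Inv x \<subseteq> \<Phi>p" by (auto simp: inversion_set_def)
  hence add: "len (w \<otimes>\<^bsub>W\<^esub> x) = len w + len x"
    using assms(4,5) by (rule len_mult_of_positive[rotated 2])
  define g where "g = w0 \<otimes>\<^bsub>W\<^esub> inv\<^bsub>W\<^esub> (w \<otimes>\<^bsub>W\<^esub> x)"
  have "g \<in> carrier W" using w0 assms(4,5) by (simp add: g_def)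
  moreover have "w0 \<otimes>\<^bsub>W\<^esub> inv\<^bsub>W\<^esub> x = g \<otimes>\<^bsub>W\<^esub> w"
    using w0 assms(4,5) by (simp add: g_def inv_mult_group m_assoc)
  moreover have "len (w0 \<otimes>\<^bsub>W\<^esub> inv\<^bsub>W\<^esub> x) + len x = len w0" "len g + len (w \<otimes>\<^bsub>W\<^esub> x) = len w0"
    unfolding g_def
    using len_longest_mult[OF assms(3), of "inv\<^bsub>W\<^esub> x"]
      len_longest_mult[OF assms(3), of "inv\<^bsub>W\<^esub> (w \<otimes>\<^bsub>W\<^esub> x)"] assms(4,5)
    by (simp_all add: len_inv del: inv_mult_group)
  ultimately show ?thesis unfolding right_divisor_def using add by (intro bexI[of _ g]) auto
qed

end
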